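(* Let $c\ge1$ and $k_1,\ldots,k_c\ge 2$. Let $R_{\mathrm{cl}}(k_1,\ldots,k_c)$ be the classical multicolor Ramsey number: the least $N$ such that every coloring of the edges of the complete graph $K_N$ with colors $1,\ldots,c$ contains, for some $i$, a complete subgraph on $k_i$ vertices all of whose edges have color $i$. Let $G_n$ be the coprime graph on vertex set $\{1,\ldots,n\}$, where distinct $a,b$ are adjacent iff $\gcd(a,b)=1$, and let $R^{\mathrm{edge}}_{\mathrm{cop}}(k_1,\ldots,k_c)$ be the least $n$ such that every coloring of the edges of $G_n$ with colors $1,\ldots,c$ contains, for some $i$, a set of $k_i$ vertices forming a clique of $G_n$ all of whose edges have color $i$. Then \[ R^{\mathrm{edge}}_{\mathrm{cop}}(k_1,\ldots,k_c)=p_{R_{\mathrm{cl}}(k_1,\ldots,k_c)-1}, \] where $p_m$ is the $m$-th prime ($p_1=2$). *)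

theory Defs
  imports "HOL-Library.Ramsey" "HOL-Library.Infinite_Set" "HOL-Computational_Algebra.Primes"
begin

text \<open>Graphs are given by a vertex set and a set of two-element edges; colours are \<open>1, \<dots>, c\<close>.\<close>

definition edge_ramsey :: "'a set \<Rightarrow> 'a set set \<Rightarrow> nat \<Rightarrow> (nat \<Rightarrow> nat) \<Rightarrow> bool" where
  "edge_ramsey V E c k \<longleftrightarrow>
     (\<forall>f \<in> E \<rightarrow> {1..c}. \<exists>i\<in>{1..c}. \<exists>S \<in> [V]\<^bsup>k i\<^esup>. clique S E \<and> (\<forall>e \<in> [S]\<^bsup>2\<^esup>. f e = i))"

definition complete_edges :: "nat \<Rightarrow> nat set set" where
  "complete_edges n = {{a, b} |a b. a \<in> {1..n} \<and> b \<in> {1..n} \<and> a \<noteq> b}"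

definition coprime_edges :: "nat \<Rightarrow> nat set set" where
  "coprime_edges n = {{a, b} |a b. a \<in> {1..n} \<and> b \<in> {1..n} \<and> a \<noteq> b \<and> gcd a b = 1}"

definition R_cl :: "nat \<Rightarrow> (nat \<Rightarrow> nat) \<Rightarrow> nat" where
  "R_cl c k = (LEAST N. edge_ramsey {1..N} (complete_edges N) c k)"

definition R_cop_edge :: "nat \<Rightarrow> (nat \<Rightarrow> nat) \<Rightarrow> nat" where
  "R_cop_edge c k = (LEAST n. edge_ramsey {1..n} (coprime_edges n) c k)"

text \<open>\<^const>\<open>enumerate\<close> counts from 0, whereas \<open>nth_prime 1 = 2\<close>; the value at 0 is irrelevant.\<close>

definition nth_prime :: "nat \<Rightarrow> nat" where
  "nth_prime m = enumerate {p. prime p} (m - 1)"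

text \<open>By Ramsey's theorem, both minima are taken over nonempty sets.\<close>

lemma edge_ramsey_transfer:
  assumes R: "edge_ramsey V E c k" and inj: "inj_on h V" and sub: "h ` V \<subseteq> V'"
    and adj: "\<And>x y. \<lbrakk>x \<in> V; y \<in> V; x \<noteq> y\<rbrakk> \<Longrightarrow> {h x, h y} \<in> E'"
    and E: "E \<subseteq> [V]\<^bsup>2\<^esup>"
  shows "edge_ramsey V' E' c k"
  unfolding edge_ramsey_def
proof
  fix f assume f: "f \<in> E' \<rightarrow> {1..c}"
  have "(\<lambda>e. f (h ` e)) \<in> E \<rightarrow> {1..c}"
  proof
    fix e assume "e \<in> E"
    then obtain x y where "e = {x, y}" "x \<in> V" "y \<in> V" "x \<noteq> y"
      using E by (fastforce simp: nsets_2_eq)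
    then show "f (h ` e) \<in> {1..c}"
      using adj f by auto
  qed
  then obtain i S where i: "i \<in> {1..c}" and S: "S \<in> [V]\<^bsup>k i\<^esup>"
    and mono: "\<forall>e \<in> [S]\<^bsup>2\<^esup>. f (h ` e) = i"
    using R unfolding edge_ramsey_def by meson
  have SV: "S \<subseteq> V" "finite S" "card S = k i" using S by (auto simp: nsets_def)
  have "h ` S \<in> [V']\<^bsup>k i\<^esup>"
    using SV sub inj by (auto simp: nsets_def card_image inj_on_subset)
  moreover have "clique (h ` S) E'"
    unfolding clique_def using SV adj by (metis (no_types, lifting) image_iff subsetD)
  moreover have "f e = i" if e: "e \<in> [h ` S]\<^bsup>2\<^esup>" for e
  proof -
    obtain a b where "e = {a, b}" "a \<in> h ` S" "b \<in> h ` S" "a \<noteq> b"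
      using e by (auto simp: nsets_2_eq)
    then obtain x y where xy: "e = h ` {x, y}" "x \<in> S" "y \<in> S" "x \<noteq> y"
      by auto
    then have "{x, y} \<in> [S]\<^bsup>2\<^esup>" by (auto simp: nsets_2_eq)
    then show ?thesis using mono xy by blast
  qed
  ultimately show "\<exists>i\<in>{1..c}. \<exists>S \<in> [V']\<^bsup>k i\<^esup>. clique S E' \<and> (\<forall>e \<in> [S]\<^bsup>2\<^esup>. f e = i)"
    using i by blast
qed

lemma edge_ramsey_lessThan: "\<exists>N::nat. edge_ramsey {..<N} ([{..<N}]\<^bsup>2\<^esup>) c k"
proof -
  let ?qs = "map k [1..<Suc c]"
  have len: "length ?qs = c" by simp
  obtain N :: nat where N: "partn_lst {..<N} ?qs 2" using ramsey_full by blast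
  have "edge_ramsey {..<N} ([{..<N}]\<^bsup>2\<^esup>) c k"
    unfolding edge_ramsey_def
  proof
    fix f assume f: "f \<in> [{..<N}]\<^bsup>2\<^esup> \<rightarrow> {1..c}"
    have "(\<lambda>e. f e - 1) \<in> [{..<N}]\<^bsup>2\<^esup> \<rightarrow> {..<length ?qs}"
      using f by (fastforce simp: Pi_iff)
    with N have "\<exists>i<length ?qs. \<exists>H \<in> [{..<N}]\<^bsup>(?qs ! i)\<^esup>. (\<lambda>e. f e - 1) ` [H]\<^bsup>2\<^esup> \<subseteq> {i}"
      unfolding partn_lst_def monochromatic_def by (rule bspec)
    then obtain i H where i: "i < c" and H: "H \<in> [{..<N}]\<^bsup>(?qs ! i)\<^esup>"
      and m: "(\<lambda>e. f e - 1) ` [H]\<^bsup>2\<^esup> \<subseteq> {i}"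
      unfolding len by blast
    have sub: "[H]\<^bsup>2\<^esup> \<subseteq> [{..<N}]\<^bsup>2\<^esup>" using H by (auto simp: nsets_def)
    have "?qs ! i = k (Suc i)" using i by (simp del: upt_Suc)
    with H have H': "H \<in> [{..<N}]\<^bsup>k (Suc i)\<^esup>" by metis
    have col: "\<forall>e \<in> [H]\<^bsup>2\<^esup>. f e = Suc i"
    proof
      fix e assume e: "e \<in> [H]\<^bsup>2\<^esup>"
      have "f e \<in> {1..c}" using f sub e by blast
      moreover have "f e - 1 = i" using m e by blast
      ultimately show "f e = Suc i" by auto
    qed
    have cl: "clique H ([{..<N}]\<^bsup>2\<^esup>)"
      using H by (auto simp: clique_def nsets_def)
    have "Suc i \<in> {1..c}" using i by simp
    then show "\<exists>i\<in>{1..c}. \<exists>S \<in> [{..<N}]\<^bsup>k i\<^esup>.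
        clique S ([{..<N}]\<^bsup>2\<^esup>) \<and> (\<forall>e \<in> [S]\<^bsup>2\<^esup>. f e = i)"
      using H' cl col by blast
  qed
  then show ?thesis by blast
qed

lemma R_cl_exists: "\<exists>N. edge_ramsey {1..N} (complete_edges N) c k"
proof -
  obtain N :: nat where N: "edge_ramsey {..<N} ([{..<N}]\<^bsup>2\<^esup>) c k" using edge_ramsey_lessThan by blast
  have "edge_ramsey {1..N} (complete_edges N) c k"
  proof (rule edge_ramsey_transfer[OF N, of Suc])
    fix x y assume "x \<in> {..<N}" "y \<in> {..<N}" "x \<noteq> y"
    then have "Suc x \<in> {1..N}" "Suc y \<in> {1..N}" "Suc x \<noteq> Suc y" by auto
    then show "{Suc x, Suc y} \<in> complete_edges N"
      unfolding complete_edges_def by blast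
  qed auto
  then show ?thesis by blast
qed

lemma R_cop_edge_exists: "\<exists>n. edge_ramsey {1..n} (coprime_edges n) c k"
proof -
  obtain N :: nat where N: "edge_ramsey {..<N} ([{..<N}]\<^bsup>2\<^esup>) c k" using edge_ramsey_lessThan by blast
  define h where "h = enumerate {p::nat. prime p}"
  have inf: "infinite {p::nat. prime p}" by (rule primes_infinite)
  have pr: "prime (h i)" for i using enumerate_in_set[OF inf, of i] unfolding h_def by (rule CollectD)
  have mono: "h i < h j" if "i < j" for i j
    using enumerate_mono[OF that inf] by (simp only: h_def)
  have inj: "inj h" by (rule linorder_injI) (metis mono less_irrefl)
  have le: "h i \<in> {1..h N}" if "i < N" for i
    using mono[OF that] prime_ge_1_nat[OF pr[of i]] by simp
  have "edge_ramsey {1..h N} (coprime_edges (h N)) c k"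
  proof (rule edge_ramsey_transfer[OF N, of h])
    fix x y assume xy: "x \<in> {..<N}" "y \<in> {..<N}" "x \<noteq> y"
    have neq: "h x \<noteq> h y" using inj xy(3) by (simp only: inj_eq not_False_eq_True)
    have "coprime (h x) (h y)" by (rule primes_coprime[OF pr pr neq])
    then have "gcd (h x) (h y) = 1" by (simp only: coprime_iff_gcd_eq_1)
    moreover have "h x \<in> {1..h N}" "h y \<in> {1..h N}" using le xy by (simp_all only: lessThan_iff)
    ultimately show "{h x, h y} \<in> coprime_edges (h N)"
      using neq unfolding coprime_edges_def
      by (intro CollectI exI[of _ "h x"] exI[of _ "h y"] conjI refl)
  next
    show "inj_on h {..<N}" using inj by (rule inj_on_subset) simp
    show "h ` {..<N} \<subseteq> {1..h N}" using le by blast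
  qed simp
  then show ?thesis by blast
qed

end

theory Submission
  imports Defs
begin

text \<open>
  Being Ramsey passes along graph homomorphisms, since a homomorphism to a loopless graph is
  injective on cliques. For \<open>N \<ge> 2\<close>, the vertices \<open>1, p\<^sub>1, \<dots>, p\<^bsub>N-1\<^esub>\<close> embed the complete graph
  on \<open>N\<close> vertices into the coprime graph up to \<open>p\<^bsub>N-1\<^esub>\<close>. Conversely, mapping a number to (the
  index of) its least prime factor is a homomorphism from the coprime graph up to \<open>n < p\<^bsub>N-1\<^esub>\<close> to
  the complete graph on \<open>N - 1\<close> vertices.
\<close>

text \<open>A colouring of \<open>E'\<close> pulls back along \<open>g\<close>, and the
  monochromatic clique found in \<open>E\<close> is mapped forward. In contrast to
  \<open>edge_ramsey_transfer\<close>, \<open>g\<close> may identify nonadjacent vertices, as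
  happens for numbers with the same least prime factor.\<close>

lemma edge_ramsey_homomorphism:
  assumes R: "edge_ramsey V E c k" and E: "E \<subseteq> [V]\<^bsup>2\<^esup>" and sub: "g ` V \<subseteq> V'"
    and hom: "\<And>x y. {x, y} \<in> E \<Longrightarrow> g x \<noteq> g y \<and> {g x, g y} \<in> E'"
  shows "edge_ramsey V' E' c k"
  unfolding edge_ramsey_def
proof
  fix f assume f: "f \<in> E' \<rightarrow> {1..c}"
  have "(\<lambda>e. f (g ` e)) \<in> E \<rightarrow> {1..c}"
  proof
    fix e assume e: "e \<in> E"
    then obtain x y where "e = {x, y}"
      using E by (fastforce simp: nsets_2_eq)
    then show "f (g ` e) \<in> {1..c}"
      using hom[of x y] e f by auto
  qed
  then obtain i S where i: "i \<in> {1..c}" and S: "S \<in> [V]\<^bsup>k i\<^esup>" and cl: "clique S E"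
    and mono: "\<forall>e \<in> [S]\<^bsup>2\<^esup>. f (g ` e) = i"
    using R unfolding edge_ramsey_def by meson
  \<comment> \<open>Distinct vertices of a clique are adjacent, so \<open>hom\<close> applies to
    every pair from \<open>S\<close> and the image keeps its \<open>k i\<close> vertices.\<close>
  have edge: "g x \<noteq> g y \<and> {g x, g y} \<in> E'" if "x \<in> S" "y \<in> S" "x \<noteq> y" for x y
    using cl hom that by (simp add: clique_def)
  then have inj: "inj_on g S"
    unfolding inj_on_def by blast
  have "g ` S \<in> [V']\<^bsup>k i\<^esup>"
    using S sub inj by (auto simp: nsets_def card_image)
  moreover have "clique (g ` S) E'"
    unfolding clique_def using edge by (metis imageE)
  moreover have "f e = i" if e: "e \<in> [g ` S]\<^bsup>2\<^esup>" for e
  proof -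
    obtain a b where "e = {a, b}" "a \<in> g ` S" "b \<in> g ` S" "a \<noteq> b"
      using e by (auto simp: nsets_2_eq)
    then obtain x y where xy: "e = g ` {x, y}" "x \<in> S" "y \<in> S" "x \<noteq> y"
      by auto
    then have "{x, y} \<in> [S]\<^bsup>2\<^esup>" by (auto simp: nsets_2_eq)
    then show ?thesis using mono xy by blast
  qed
  ultimately show "\<exists>i\<in>{1..c}. \<exists>S \<in> [V']\<^bsup>k i\<^esup>. clique S E' \<and> (\<forall>e \<in> [S]\<^bsup>2\<^esup>. f e = i)"
    using i by blast
qed

lemma doubleton_in_complete_edges_iff:
  "{x, y} \<in> complete_edges n \<longleftrightarrow> x \<in> {1..n} \<and> y \<in> {1..n} \<and> x \<noteq> y"
  unfolding complete_edges_def by (auto simp: doubleton_eq_iff)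

lemma doubleton_in_coprime_edges_iff:
  "{x, y} \<in> coprime_edges n \<longleftrightarrow> x \<in> {1..n} \<and> y \<in> {1..n} \<and> x \<noteq> y \<and> coprime x y"
  unfolding coprime_edges_def
  by (auto simp: doubleton_eq_iff coprime_iff_gcd_eq_1 gcd.commute)

lemma complete_edges_subset: "complete_edges n \<subseteq> [{1..n}]\<^bsup>2\<^esup>"
  unfolding complete_edges_def by (auto simp: nsets_def card_insert_if)

lemma coprime_edges_subset: "coprime_edges n \<subseteq> [{1..n}]\<^bsup>2\<^esup>"
proof -
  have "coprime_edges n \<subseteq> complete_edges n"
    unfolding coprime_edges_def complete_edges_def by blast
  then show ?thesis using complete_edges_subset by blast
qed

text \<open>The enumeration starts at index 0, so the (N-1)-th prime appears below as
  \<open>prime_seq (N - 2)\<close>.\<close>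

definition prime_seq :: "nat \<Rightarrow> nat" where
  "prime_seq = enumerate {p. prime p}"

lemma prime_prime_seq: "prime (prime_seq i)"
  unfolding prime_seq_def using enumerate_in_set[OF primes_infinite, of i] by (rule CollectD)

lemma prime_seq_less_iff: "prime_seq i < prime_seq j \<longleftrightarrow> i < j"
  unfolding prime_seq_def by (rule enumerate_mono_iff[OF primes_infinite])

lemma prime_seq_eq_iff: "prime_seq i = prime_seq j \<longleftrightarrow> i = j"
  by (metis prime_seq_less_iff less_irrefl nat_neq_iff)

lemma prime_seq_dvd_exists:
  assumes "x \<noteq> 1"
  shows "\<exists>i. prime_seq i dvd x"
proof -
  obtain p where "prime p" "p dvd x"
    using assms prime_factor_nat by blast
  then show ?thesis
    unfolding prime_seq_def using enumerate_Ex[OF primes_infinite] by (metis mem_Collect_eq)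
qed

lemma edge_ramsey_coprime_if_complete:
  assumes R: "edge_ramsey {1..N} (complete_edges N) c k" and N: "2 \<le> N"
  shows "edge_ramsey {1..prime_seq (N - 2)} (coprime_edges (prime_seq (N - 2))) c k"
proof -
  \<comment> \<open>The number 1 is coprime to every prime and supplies one extra vertex; thus
    \<open>N\<close> vertices need only the \<open>N - 1\<close> primes with indices 0 to
    \<open>N - 2\<close>.\<close>
  define g where "g j = (if j = 1 then 1 else prime_seq (j - 2))" for j
  have range: "g j \<in> {1..prime_seq (N - 2)}" if "j \<in> {1..N}" for j
  proof -
    have "\<not> prime_seq (N - 2) < prime_seq (j - 2)"
      using that by (simp only: prime_seq_less_iff) auto
    then show ?thesis
      using prime_ge_1_nat[OF prime_prime_seq] by (simp add: g_def)
  qed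
  have "g x \<noteq> g y \<and> coprime (g x) (g y)" if "x \<in> {1..N}" "y \<in> {1..N}" "x \<noteq> y" for x y
  proof -
    have "prime_seq (x - 2) \<noteq> prime_seq (y - 2)" if "x \<noteq> 1" "y \<noteq> 1"
      using that \<open>x \<in> _\<close> \<open>y \<in> _\<close> \<open>x \<noteq> y\<close> by (simp only: prime_seq_eq_iff) auto
    moreover have "1 < prime_seq (x - 2)" "1 < prime_seq (y - 2)"
      by (rule prime_gt_1_nat[OF prime_prime_seq])+
    ultimately show ?thesis
      using \<open>x \<noteq> y\<close> primes_coprime[OF prime_prime_seq prime_prime_seq, of "x - 2" "y - 2"]
      by (cases "x = 1"; cases "y = 1") (auto simp: g_def)
  qed
  then show ?thesis
    using range
    by (intro edge_ramsey_homomorphism[OF R complete_edges_subset, of g])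
       (auto simp only: doubleton_in_complete_edges_iff doubleton_in_coprime_edges_iff)
qed

lemma edge_ramsey_complete_if_coprime:
  assumes R: "edge_ramsey {1..n} (coprime_edges n) c k"
    and N: "2 \<le> N" and n: "n < prime_seq (N - 2)"
  shows "edge_ramsey {1..N - 1} (complete_edges (N - 1)) c k"
proof -
  define l where "l x = (LEAST i. prime_seq i dvd x)" for x
  \<comment> \<open>The number 1 has no prime factor, so \<open>l 1\<close> is unspecified and 1
    gets its own vertex. The shift by 2 sends the indices below \<open>N - 2\<close> to the
    remaining vertices 2 to \<open>N - 1\<close>.\<close>
  define g where "g x = (if x = 1 then 1 else l x + 2)" for x :: nat
  have l: "prime_seq (l x) dvd x" if "x \<noteq> 1" for x
    unfolding l_def using prime_seq_dvd_exists[OF that] by (rule LeastI_ex)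
  have range: "g x \<in> {1..N - 1}" if x: "x \<in> {1..n}" for x
  proof (cases "x = 1")
    case True
    then show ?thesis using N by (simp add: g_def)
  next
    case False
    have "prime_seq (l x) \<le> x"
      using dvd_imp_le[OF l[OF False]] x by simp
    then have "prime_seq (l x) < prime_seq (N - 2)"
      using x n by simp
    then have "l x < N - 2"
      by (simp only: prime_seq_less_iff)
    then show ?thesis
      using False by (simp add: g_def)
  qed
  have "g x \<noteq> g y" if xy: "x \<noteq> y" "coprime x y" for x y
  proof
    assume eq: "g x = g y"
    \<comment> \<open>Only 1 is mapped to 1, so distinct numbers with equal images both differ from
      1 and share their least prime factor.\<close>
    then have ne: "x \<noteq> 1" "y \<noteq> 1" and "l x = l y"
      using xy by (auto simp: g_def split: if_splits)
    then have "prime_seq (l x) dvd x" "prime_seq (l x) dvd y"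
      using l by metis+
    then have "is_unit (prime_seq (l x))"
      using xy(2) coprime_common_divisor by blast
    then show False
      using prime_prime_seq not_prime_unit by blast
  qed
  then show ?thesis
    using range
    by (intro edge_ramsey_homomorphism[OF R coprime_edges_subset, of g])
       (auto simp only: doubleton_in_complete_edges_iff doubleton_in_coprime_edges_iff)
qed

text \<open>With at most one vertex there are no edges to colour, yet a set of at least two vertices
  would have to exist. The bound keeps the subtractions \<open>N - 1\<close> and
  \<open>N - 2\<close> from being truncated.\<close>

lemma edge_ramsey_complete_ge_2:
  assumes R: "edge_ramsey {1..N} (complete_edges N) c k"
    and k: "\<And>i. i \<in> {1..c} \<Longrightarrow> k i \<ge> 2"
  shows "2 \<le> N"
proof (rule ccontr)
  assume "\<not> 2 \<le> N"
  then have "complete_edges N = {}"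
    by (auto simp: complete_edges_def)
  then obtain i S where "i \<in> {1..c}" "S \<in> [{1..N}]\<^bsup>k i\<^esup>"
    using R unfolding edge_ramsey_def by auto
  then have "k i \<le> N"
    using card_mono[of "{1..N}" S] by (auto simp: nsets_def)
  then show False
    using k[OF \<open>i \<in> {1..c}\<close>] \<open>\<not> 2 \<le> N\<close> by simp
qed

theorem theorem4p4:
  fixes c :: nat and k :: "nat \<Rightarrow> nat"
  assumes "c \<ge> 1" and "\<And>i. i \<in> {1..c} \<Longrightarrow> k i \<ge> 2"
  shows "R_cop_edge c k = nth_prime (R_cl c k - 1)"
proof -
  define N where "N = R_cl c k"
  have R: "edge_ramsey {1..N} (complete_edges N) c k"
    unfolding N_def R_cl_def by (rule LeastI_ex[OF R_cl_exists])
  have N: "2 \<le> N"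
    using edge_ramsey_complete_ge_2[OF R] assms(2) by blast
  have least: "\<not> edge_ramsey {1..N - 1} (complete_edges (N - 1)) c k"
    using not_less_Least[of "N - 1" "\<lambda>N. edge_ramsey {1..N} (complete_edges N) c k"] N
    by (simp add: N_def R_cl_def)
  have "R_cop_edge c k = prime_seq (N - 2)"
    unfolding R_cop_edge_def
  proof (rule Least_equality)
    show "edge_ramsey {1..prime_seq (N - 2)} (coprime_edges (prime_seq (N - 2))) c k"
      by (rule edge_ramsey_coprime_if_complete[OF R N])
  next
    \<comment> \<open>A smaller \<open>n\<close> would make the complete graph on
      \<open>N - 1\<close> vertices Ramsey, against the minimality of \<open>N\<close>.\<close>
    fix n assume "edge_ramsey {1..n} (coprime_edges n) c k"
    then show "prime_seq (N - 2) \<le> n"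
      using edge_ramsey_complete_if_coprime[OF _ N] least by (meson not_le)
  qed
  moreover have "N - 1 - 1 = N - 2" by simp
  ultimately show ?thesis
    by (simp only: nth_prime_def prime_seq_def N_def)
qed

end
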